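(* If $E(\lambda)$ is a $\top$-even $n\times n$ matrix pencil with $\operatorname{rank}E=r\leq n$, then it can be written as $$E(\lambda)=\begin{cases}v_1w_1(\lambda)^\top+\cdots+v_sw_s(\lambda)^\top+w_1(-\lambda)v_1^\top+\cdots+w_s(-\lambda)v_s^\top,&\text{if } r \text{ is even},\\ uu^\top+v_1w_1(\lambda)^\top+\cdots+v_sw_s(\lambda)^\top+w_1(-\lambda)v_1^\top+\cdots+w_s(-\lambda)v_s^\top,&\text{if } r \text{ is odd},\end{cases}$$ where $u,v_j,w_j\in\mathbb C[\lambda]^n$, $s=\lfloor r/2\rfloor$, $\deg u=\deg v_1=\cdots=\deg v_s=0$ and $\deg w_1,\dots,\deg w_s\leq 1$.
   Context: A matrix pencil $E(\lambda)=A+\lambda B$ with $A,B\in\mathbb C^{n\times n}$ is $\top$-even if $A^\top=A$ and $B^\top=-B$. Its rank is the normal rank, i.e. the rank as a matrix over the field of rational functions, $\max_{\lambda\in\mathbb C}\operatorname{rank}(A+\lambda B)$. For $v(\lambda)\in\mathbb C[\lambda]^n$, $\deg v$ is the largest degree of the entries of $v$; so $\deg v=0$ means that $v$ is a constant vector in $\mathbb C^n$. *)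

theory Defs
  imports "HOL-Analysis.Analysis" "HOL-Computational_Algebra.Polynomial"
begin

text \<open>Matrices and vectors over \<open>\<complex>[\<lambda>]\<close> are represented with entries in \<^typ>\<open>complex poly\<close>,
  so \<open>[:a, b:]\<close> stands for \<open>a + \<lambda> b\<close>.\<close>

definition pencil :: "complex^'n^'m \<Rightarrow> complex^'n^'m \<Rightarrow> complex poly^'n^'m" where
  "pencil A B = (\<chi> i j. [:A $ i $ j, B $ i $ j:])"

definition T_even_pencil :: "complex poly^'n^'n \<Rightarrow> bool" where
  "T_even_pencil E \<longleftrightarrow> (\<exists>A B. E = pencil A B \<and> transpose A = A \<and> transpose B = - B)"

definition eval_pmat :: "complex poly^'n^'m \<Rightarrow> complex \<Rightarrow> complex^'n^'m" where
  "eval_pmat E z = (\<chi> i j. poly (E $ i $ j) z)"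

lemma eval_pmat_pencil: "eval_pmat (pencil A B) z = A + (\<chi> i j. z * B $ i $ j)"
  by (simp add: eval_pmat_def pencil_def vec_eq_iff)

definition normal_rank :: "complex poly^'n^'m \<Rightarrow> nat" where
  "normal_rank E = Max (range (\<lambda>z. rank (eval_pmat E z)))"

text \<open>The ranks are bounded by the dimension, so this maximum is attained.\<close>

lemma finite_range_rank_eval: "finite (range (\<lambda>z. rank (eval_pmat (E :: complex poly^'n^'m) z)))"
proof (rule finite_subset)
  have "rank M \<le> CARD('n)" for M :: "complex^'n^'m"
    using vec.dim_subset[of "rows M" UNIV] by (simp add: row_rank_def_gen card_cart_basis)
  then show "range (\<lambda>z. rank (eval_pmat E z)) \<subseteq> {..CARD('n)}"
    by blast
qed simp

text \<open>With the convention \<open>degree 0 = 0\<close>, degree 0 means that the vector is constant (possibly zero).\<close>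

definition vec_degree :: "complex poly^'n \<Rightarrow> nat" where
  "vec_degree v = Max (range (\<lambda>i. degree (v $ i)))"

definition outer :: "complex poly^'m \<Rightarrow> complex poly^'n \<Rightarrow> complex poly^'n^'m" where
  "outer v w = (\<chi> i j. v $ i * w $ j)"

text \<open>The substitution \<open>\<lambda> \<mapsto> -\<lambda>\<close>.\<close>

definition reflect_vec :: "complex poly^'n \<Rightarrow> complex poly^'n" where
  "reflect_vec w = (\<chi> i. pcompose (w $ i) [:0, -1:])"

end

theory Submission
  imports Defs "HOL-Computational_Algebra.Fundamental_Theorem_Algebra"
begin

text \<open>
  A decomposition with \<open>s\<close> pairs of outer products says that, up to the term \<open>uu\<^sup>T\<close>, both
  coefficients vanish on a common subspace of dimension at least \<open>n - s\<close>. The proof therefore treats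
  \<open>A\<close> and \<open>B\<close> as a symmetric form \<open>a\<close> and a skew form \<open>b\<close> and works by induction on the dimension
  of a subspace \<open>S\<close>, in a way that does not distinguish regular from singular pencils and needs no
  canonical form.

  The engine is an isotropic eigenvector: some \<open>x \<noteq> 0\<close> in \<open>S\<close> with \<open>a(x,x) = 0\<close> for which the
  functionals \<open>a(\<cdot>,x)\<close> and \<open>b(\<cdot>,x)\<close> are linearly dependent. Any eigenvector of the pencil for a finite
  eigenvalue is isotropic by itself, because \<open>b(x,x) = 0\<close>. Only eigenvectors at infinity, where
  \<open>b(\<cdot>,x) = 0\<close>, may be anisotropic; but if \<open>dim S \<ge> 2\<close> the \<open>a\<close>-complement of such a vector has an
  eigenvector too, and two orthogonal anisotropic vectors in the kernel of \<open>b\<close> combine to an isotropic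
  one over \<open>\<complex>\<close> (\<open>ex_isotropic_eigenvector\<close>).

  If \<open>x\<close> lies in the radical of both forms, it can be split off without changing the rank. Otherwise
  \<open>a(\<cdot>,x)\<close> and \<open>b(\<cdot>,x)\<close> are multiples of one functional \<open>f\<close>, and \<open>x\<close> is in the radical of the
  restriction to \<open>ker f\<close>. Passing to \<open>ker f\<close> modulo \<open>x\<close> lowers the dimension by two and the rank of
  \<open>a + zb\<close> by two for almost all \<open>z\<close> (\<open>rank_drop\<close>), while going back from \<open>ker f\<close> to \<open>S\<close>
  costs exactly one pair of outer products, whose constant factor is \<open>f\<close>
  (\<open>short_decomposition_hyperplane\<close>). The induction ends at zero or on a line; in the latter case
  an anisotropic vector gives the term \<open>uu\<^sup>T\<close> if the rank is odd.
\<close>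

section \<open>Linear functionals and hyperplane sections\<close>

abbreviation functional :: "(complex^'n \<Rightarrow> complex) \<Rightarrow> bool" where
  "functional \<equiv> Vector_Spaces.linear (*s) (*)"

lemma functionalI:
  assumes "\<And>x y. f (x + y) = f x + f y" "\<And>c x. f (c *s x) = c * f x"
  shows "functional f"
  unfolding Vector_Spaces.linear_iff using assms
  by (auto intro: vec.vector_space_axioms vector_space_over_itself.vector_space_axioms)

lemma functional_simps:
  assumes "functional f"
  shows "f (x + y) = f x + f y" "f (c *s x) = c * f x" "f 0 = 0" "f (x - y) = f x - f y"
proof -
  interpret f: Vector_Spaces.linear "(*s)" "(*)" f by fact
  show "f (x + y) = f x + f y" "f (c *s x) = c * f x" "f 0 = 0" "f (x - y) = f x - f y"
    by (simp_all add: f.add f.scale f.zero f.diff)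
qed

lemma functional_sum: "functional f \<Longrightarrow> f (\<Sum>i\<in>I. g i) = (\<Sum>i\<in>I. f (g i))"
  by (induction I rule: infinite_finite_induct) (simp_all add: functional_simps)

lemma functional_coordinate: "functional (\<lambda>x. x $ i)"
  by (rule functionalI) simp_all

lemma functional_lincomb:
  "functional f \<Longrightarrow> functional g \<Longrightarrow> functional (\<lambda>x. c * f x + d * g x)"
  by (rule functionalI) (simp_all add: functional_simps algebra_simps)

lemma subspace_kernel_section:
  "functional f \<Longrightarrow> vec.subspace S \<Longrightarrow> vec.subspace {x \<in> S. f x = 0}"
  by (auto simp: vec.subspace_def functional_simps)

lemma dim_hyperplane_section:
  assumes f: "functional f" and S: "vec.subspace S" and x: "x \<in> S" "f x \<noteq> 0"
  shows "vec.dim S = vec.dim {y \<in> S. f y = 0} + 1"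
proof -
  let ?K = "{y \<in> S. f y = 0}"
  have K: "vec.subspace ?K" using f S by (rule subspace_kernel_section)
  have "y \<in> vec.span (insert x ?K)" if "y \<in> S" for y
  proof -
    have "y - (f y / f x) *s x \<in> ?K"
      using that x S f by (auto simp: functional_simps vec.subspace_diff vec.subspace_scale)
    then show ?thesis
      unfolding vec.span_breakdown_eq by (intro exI[of _ "f y / f x"] vec.span_base)
  qed
  moreover have "insert x ?K \<subseteq> S" using x by auto
  ultimately have "vec.span (insert x ?K) = S"
    using S by (meson subsetI subset_antisym vec.span_minimal)
  then have "vec.dim S = vec.dim (insert x ?K)"
    using vec.dim_span by metis
  also have "\<dots> = vec.dim ?K + 1"
    using x by (simp add: vec.dim_insert vec.span_eq_iff[THEN iffD2, OF K])
  finally show ?thesis .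
qed

lemma dim_hyperplane_section_le:
  assumes f: "functional f" and S: "vec.subspace S"
  shows "vec.dim S \<le> vec.dim {y \<in> S. f y = 0} + 1"
proof (cases "\<exists>x\<in>S. f x \<noteq> 0")
  case True
  then obtain x where "x \<in> S" "f x \<noteq> 0" by blast
  then show ?thesis using dim_hyperplane_section[OF f S] by simp
next
  case False
  then have "{y \<in> S. f y = 0} = S" by auto
  then show ?thesis by simp
qed

lemma dim_common_kernel:
  assumes "finite G" "\<And>g. g \<in> G \<Longrightarrow> functional g" and S: "vec.subspace S"
  shows "vec.dim S \<le> vec.dim {y \<in> S. \<forall>g\<in>G. g y = 0} + card G"
    and "vec.subspace {y \<in> S. \<forall>g\<in>G. g y = 0}"
  using assms(1,2)
proof (induction G rule: finite_induct)
  case empty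
  { case 1 show ?case by simp next case 2 show ?case using S by simp }
next
  case (insert g G)
  let ?K = "{y \<in> S. \<forall>g\<in>G. g y = 0}"
  have eq: "{y \<in> S. \<forall>h\<in>insert g G. h y = 0} = {y \<in> ?K. g y = 0}" by auto
  {
    case 1
    have "vec.dim S \<le> vec.dim ?K + card G" "vec.subspace ?K" using insert 1 by auto
    moreover have "vec.dim ?K \<le> vec.dim {y \<in> ?K. g y = 0} + 1"
      using 1 \<open>vec.subspace ?K\<close> by (intro dim_hyperplane_section_le) auto
    ultimately show ?case using insert unfolding eq by simp
  next
    case 2
    then show ?case unfolding eq using insert by (intro subspace_kernel_section) auto
  }
qed

text \<open>The rank is the dimension of the row space, and the kernel of \<open>M\<close> is cut out by the functionals
  of a basis of the rows, each of which costs at most one dimension.\<close>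

lemma dim_matrix_kernel:
  fixes M :: "complex^'n^'m"
  shows "CARD('n) \<le> vec.dim {y. M *v y = 0} + rank M"
proof -
  obtain B where B: "B \<subseteq> rows M" "vec.independent B" "rows M \<subseteq> vec.span B" "card B = rank M"
    unfolding row_rank_def_gen by (rule vec.basis_exists)
  define g where "g = (\<lambda>(r :: complex^'n) y. \<Sum>j\<in>UNIV. r $ j * y $ j)"
  have g: "functional (g r)" for r
    by (rule functionalI) (simp_all add: g_def sum.distrib sum_distrib_left algebra_simps)
  have g': "functional (\<lambda>r. g r y)" for y
    by (rule functionalI) (simp_all add: g_def sum.distrib sum_distrib_left algebra_simps)
  have "finite B" using B(2) by (rule vec.finiteI_independent)
  have "{y. \<forall>h\<in>g ` B. h y = 0} \<subseteq> {y. M *v y = 0}"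
  proof safe
    fix y assume y: "\<forall>h\<in>g ` B. h y = 0"
    have "vec.span B \<subseteq> {r. g r y = 0}"
      using y subspace_kernel_section[OF g' vec.subspace_UNIV, of y] by (intro vec.span_minimal) auto
    then have "g (row i M) y = 0" for i
      using B(3) by (auto simp: rows_def)
    then show "M *v y = 0"
      by (simp add: vec_eq_iff matrix_vector_mult_def g_def row_def)
  qed
  then have "vec.dim {y. \<forall>h\<in>g ` B. h y = 0} \<le> vec.dim {y. M *v y = 0}"
    by (rule vec.dim_subset)
  moreover have "vec.dim (UNIV :: (complex^'n) set) \<le> vec.dim {y \<in> UNIV. \<forall>h\<in>g ` B. h y = 0} + card (g ` B)"
    using \<open>finite B\<close> g by (intro dim_common_kernel) auto
  moreover have "card (g ` B) \<le> rank M" using B(4) \<open>finite B\<close> card_image_le by metis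
  ultimately show ?thesis by (simp only: vec_dim_card) simp
qed

section \<open>Eigenvectors of pencils\<close>

text \<open>If \<open>Q\<close> is bijective on \<open>S\<close>, this is the existence of an eigenvector of \<open>Q\<inverse>P\<close>. A Krylov chain
  \<open>y\<^sub>k\<^sub>+\<^sub>1 = Q\<inverse>P y\<^sub>k\<close> satisfies a polynomial relation \<open>p\<close>; for \<open>p\<close> of least degree with root \<open>z\<close>,
  the quotient \<open>p / (X - z)\<close> evaluates on the chain to an eigenvector.\<close>

lemma kernel_of_operator_pencil:
  fixes P Q :: "complex^'n \<Rightarrow> complex^'n"
  assumes P: "Vector_Spaces.linear (*s) (*s) P" and Q: "Vector_Spaces.linear (*s) (*s) Q"
    and S: "vec.subspace S" "S \<noteq> {0}"
    and PS: "\<And>x. x \<in> S \<Longrightarrow> P x \<in> S" and QS: "\<And>x. x \<in> S \<Longrightarrow> Q x \<in> S"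
  shows "\<exists>x\<in>S. x \<noteq> 0 \<and> (\<exists>\<alpha> \<beta>. (\<alpha> \<noteq> 0 \<or> \<beta> \<noteq> 0) \<and> \<alpha> *s P x + \<beta> *s Q x = 0)"
proof (cases "inj_on Q S")
  case False
  interpret Q: Vector_Spaces.linear "(*s)" "(*s)" Q by fact
  obtain x y where xy: "x \<in> S" "y \<in> S" "x \<noteq> y" "Q x = Q y"
    using False by (auto simp: inj_on_def)
  have "x - y \<in> S" "x - y \<noteq> 0" "0 *s P (x - y) + 1 *s Q (x - y) = 0"
    using xy S by (auto simp: Q.diff vec.subspace_diff)
  then show ?thesis by (metis zero_neq_one)
next
  case True
  interpret P: Vector_Spaces.linear "(*s)" "(*s)" P by fact
  interpret Q: Vector_Spaces.linear "(*s)" "(*s)" Q by fact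
  have "vec.dim (Q ` S) = vec.dim S"
    using True S(1) by (intro vec.dim_image_eq[OF Q]) (simp add: vec.span_eq_iff[THEN iffD2])
  then have surj: "Q ` S = S"
    using S QS by (intro vec.subspace_dim_equal) (auto intro: Q.subspace_image)
  obtain y0 where y0: "y0 \<in> S" "y0 \<noteq> 0"
    using S vec.subspace_0 by blast
  define y where "y = rec_nat y0 (\<lambda>_ v. SOME u. u \<in> S \<and> Q u = P v)"
  have y_step: "y (Suc k) \<in> S \<and> Q (y (Suc k)) = P (y k)" if "y k \<in> S" for k
  proof -
    have "\<exists>u. u \<in> S \<and> Q u = P (y k)" using surj PS[OF that] by (metis imageE)
    then show ?thesis unfolding y_def by (simp) (rule someI_ex)
  qed
  have yS: "y k \<in> S" for k
  proof (induction k)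
    case 0 then show ?case using y0 by (simp add: y_def)
  next
    case (Suc k) then show ?case using y_step by blast
  qed
  have Qy: "Q (y (Suc k)) = P (y k)" for k using y_step yS by blast
  \<comment> \<open>the value of \<open>p(Q\<inverse>P)\<close> at \<open>y\<^sub>0\<close>\<close>
  define ev where "ev p = (\<Sum>k\<le>degree p. coeff p k *s y k)" for p :: "complex poly"
  have ev_bound: "ev p = (\<Sum>k\<le>n. coeff p k *s y k)" if "degree p \<le> n" for p n
    unfolding ev_def using that
    by (intro sum.mono_neutral_left) (auto simp: coeff_eq_0)
  have ev_S: "ev p \<in> S" for p
    unfolding ev_def using S yS by (intro vec.subspace_sum vec.subspace_scale) auto
  have "\<exists>p. p \<noteq> 0 \<and> ev p = 0"
  proof (cases "inj y")
    case False
    then obtain i j where ij: "i \<noteq> j" "y i = y j" by (auto simp: inj_on_def)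
    define p :: "complex poly" where "p = monom 1 i - monom 1 j"
    have "coeff p i = 1" using ij by (simp add: p_def)
    then have "p \<noteq> 0" by auto
    have "degree p \<le> max i j" unfolding p_def by (rule degree_diff_le) (simp_all add: degree_monom_eq)
    then have "ev p = (\<Sum>k\<le>max i j. coeff p k *s y k)" by (rule ev_bound)
    also have "\<dots> = (\<Sum>k\<le>max i j. if k = i then y i else 0) - (\<Sum>k\<le>max i j. if k = j then y j else 0)"
      unfolding sum_subtractf[symmetric] by (rule sum.cong) (auto simp: p_def vec.scale_left_diff_distrib)
    also have "\<dots> = 0" using ij by simp
    finally show ?thesis using \<open>p \<noteq> 0\<close> by blast
  next
    case True
    define d where "d = vec.dim S"
    have inj: "inj_on y {..d}" using True inj_on_subset by blast
    have "vec.dependent (y ` {..d})"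
    proof (rule ccontr)
      assume "vec.independent (y ` {..d})"
      then have "card (y ` {..d}) \<le> d"
        unfolding d_def using yS by (intro vec.independent_card_le_dim) auto
      then show False using inj by (simp add: card_image)
    qed
    then obtain c v where c: "v \<in> y ` {..d}" "c v \<noteq> 0" "(\<Sum>v\<in>y ` {..d}. c v *s v) = 0"
      using vec.dependent_finite[of "y ` {..d}"] by auto
    define p where "p = (\<Sum>k\<le>d. monom (c (y k)) k)"
    have cp: "coeff p k = (if k \<le> d then c (y k) else 0)" for k
      by (simp add: p_def coeff_sum)
    have "p \<noteq> 0"
      using c(1,2) cp by (metis atMost_iff coeff_0 imageE)
    moreover have "degree p \<le> d" by (rule degree_le) (simp add: cp)
    then have "ev p = (\<Sum>k\<le>d. coeff p k *s y k)" by (rule ev_bound)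
    then have "ev p = 0" using c(3) inj by (simp add: cp sum.reindex)
    ultimately show ?thesis by blast
  qed
  then obtain p0 where "p0 \<noteq> 0 \<and> ev p0 = 0" by blast
  from ex_has_least_nat[of "\<lambda>p. p \<noteq> 0 \<and> ev p = 0", OF this, of degree]
  obtain p where p: "p \<noteq> 0" "ev p = 0"
    and p_min: "\<And>q. q \<noteq> 0 \<Longrightarrow> ev q = 0 \<Longrightarrow> degree p \<le> degree q"
    by blast
  have "degree p \<noteq> 0"
  proof
    assume deg: "degree p = 0"
    then obtain c where c: "p = [:c:]" by (rule degree_eq_zeroE)
    with p have "c *s y 0 = 0" "c \<noteq> 0" by (auto simp: ev_def)
    then show False using y0 by (simp add: y_def)
  qed
  then obtain z where "poly p z = 0"
    using fundamental_theorem_of_algebra_alt[of p] by (metis degree_pCons_0)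
  then obtain q where pq: "p = [:-z, 1:] * q"
    by (metis dvdE poly_eq_0_iff_dvd)
  have "q \<noteq> 0" using p pq by auto
  then have deg: "degree p = Suc (degree q)"
    unfolding pq by (subst degree_mult_eq) auto
  define x where "x = ev q"
  have "x \<noteq> 0" using p_min[OF \<open>q \<noteq> 0\<close>] deg by (auto simp: x_def)
  let ?n = "degree q"
  have "(\<Sum>k\<le>Suc ?n. coeff (pCons 0 q) k *s y k) = (\<Sum>k\<le>?n. coeff q k *s y (Suc k))"
    by (subst sum.atMost_Suc_shift) simp
  moreover have "(\<Sum>k\<le>Suc ?n. coeff q k *s y k) = x"
    using ev_bound[of q "Suc ?n"] by (simp add: x_def)
  moreover have "ev p = (\<Sum>k\<le>Suc ?n. coeff (pCons 0 q) k *s y k) - z *s (\<Sum>k\<le>Suc ?n. coeff q k *s y k)"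
    unfolding ev_def deg vec.scale_sum_right sum_subtractf[symmetric]
    by (rule sum.cong) (simp_all add: pq vec.scale_left_diff_distrib)
  ultimately have shift: "(\<Sum>k\<le>?n. coeff q k *s y (Suc k)) = z *s x" using p by simp
  have "P x = (\<Sum>k\<le>?n. coeff q k *s P (y k))"
    by (simp add: x_def ev_def P.sum P.scale)
  also have "\<dots> = Q (\<Sum>k\<le>?n. coeff q k *s y (Suc k))"
    by (simp add: Q.sum Q.scale Qy)
  also have "\<dots> = z *s Q x" by (simp add: shift Q.scale)
  finally have "1 *s P x + (- z) *s Q x = 0" by simp
  then show ?thesis using \<open>x \<noteq> 0\<close> ev_S[of q] unfolding x_def by (metis one_neq_zero)
qed

text \<open>A basis \<open>B\<close> of \<open>S\<close> turns a form into the operator \<open>x \<mapsto> \<Sum>\<^sub>s a(s,x) s\<close> on \<open>S\<close>, summed over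
  \<open>s \<in> B\<close>, with the same right kernel. This avoids dual spaces.\<close>

lemma kernel_of_form_pencil:
  fixes a b :: "complex^'n \<Rightarrow> complex^'n \<Rightarrow> complex"
  assumes a: "\<And>x. functional (a x)" "\<And>y. functional (\<lambda>x. a x y)"
    and b: "\<And>x. functional (b x)" "\<And>y. functional (\<lambda>x. b x y)"
    and S: "vec.subspace S" "S \<noteq> {0}"
  shows "\<exists>x\<in>S. x \<noteq> 0 \<and> (\<exists>\<alpha> \<beta>. (\<alpha> \<noteq> 0 \<or> \<beta> \<noteq> 0) \<and> (\<forall>s\<in>S. \<alpha> * a s x + \<beta> * b s x = 0))"
proof -
  obtain B where B: "B \<subseteq> S" "vec.independent B" "S \<subseteq> vec.span B"
    by (rule vec.basis_exists)
  have "finite B" using B(2) by (rule vec.finiteI_independent)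
  define P where "P x = (\<Sum>s\<in>B. a s x *s s)" for x
  define Q where "Q x = (\<Sum>s\<in>B. b s x *s s)" for x
  have lin: "Vector_Spaces.linear (*s) (*s) P" "Vector_Spaces.linear (*s) (*s) Q"
    unfolding Vector_Spaces.linear_iff P_def Q_def
    by (auto simp: functional_simps[OF a(1)] functional_simps[OF b(1)] vec.scale_left_distrib
        sum.distrib vec.scale_sum_right vec.vector_space_axioms)
  have "P x \<in> S" "Q x \<in> S" for x
    unfolding P_def Q_def using B(1) S(1) by (auto intro!: vec.subspace_sum vec.subspace_scale)
  then obtain x \<alpha> \<beta> where x: "x \<in> S" "x \<noteq> 0" "\<alpha> \<noteq> 0 \<or> \<beta> \<noteq> 0" "\<alpha> *s P x + \<beta> *s Q x = 0"
    using kernel_of_operator_pencil[OF lin S] by blast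
  have "(\<Sum>s\<in>B. (\<alpha> * a s x + \<beta> * b s x) *s s) = 0"
    using x(4) by (simp add: P_def Q_def vec.scale_sum_right sum.distrib vec.scale_left_distrib)
  then have "\<alpha> * a s x + \<beta> * b s x = 0" if "s \<in> B" for s
    using B(2) that vec.dependent_finite[OF \<open>finite B\<close>] by fastforce
  moreover have "vec.subspace {s. \<alpha> * a s x + \<beta> * b s x = 0}"
    using subspace_kernel_section[OF functional_lincomb[OF a(2) b(2)] vec.subspace_UNIV] by simp
  ultimately have "vec.span B \<subseteq> {s. \<alpha> * a s x + \<beta> * b s x = 0}"
    by (intro vec.span_minimal) auto
  then show ?thesis using x B(3) by blast
qed

section \<open>A symmetric and a skew-symmetric form on the same subspace\<close>

locale even_form_pair =
  fixes a b :: "complex^'n \<Rightarrow> complex^'n \<Rightarrow> complex"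
  assumes functional_a: "functional (a x)" and functional_b: "functional (b x)"
    and sym: "a x y = a y x" and skew: "b x y = - b y x"
begin

lemma functional_a': "functional (\<lambda>x. a x y)"
  using functional_a[of y] by (simp add: sym[of _ y])

lemma functional_b': "functional (\<lambda>x. b x y)"
proof (rule functionalI)
  show "b (x + x') y = b x y + b x' y" for x x'
    using functional_simps(1)[OF functional_b, of y x x'] by (simp add: skew[of _ y])
  show "b (c *s x) y = c * b x y" for c x
    using functional_simps(2)[OF functional_b, of y c x] by (simp add: skew[of _ y])
qed

lemmas form_simps = functional_simps[OF functional_a] functional_simps[OF functional_a']
  functional_simps[OF functional_b] functional_simps[OF functional_b']

lemma b_diag: "b x x = 0"
  using skew[of x x] by simp

definition isotropic_eigenvector :: "(complex^'n) set \<Rightarrow> complex^'n \<Rightarrow> bool" where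
  "isotropic_eigenvector S x \<longleftrightarrow> x \<in> S \<and> x \<noteq> 0 \<and> a x x = 0 \<and>
     (\<exists>\<alpha> \<beta>. (\<alpha> \<noteq> 0 \<or> \<beta> \<noteq> 0) \<and> (\<forall>s\<in>S. \<alpha> * a s x + \<beta> * b s x = 0))"

text \<open>For an eigenvector \<open>x\<close>, inserting \<open>x\<close> into \<open>\<alpha> a(\<cdot>,x) + \<beta> b(\<cdot>,x) = 0\<close> gives
  \<open>\<alpha> a(x,x) = 0\<close>, so it is isotropic unless the eigenvalue is infinite, \<open>\<alpha> = 0\<close>.\<close>

lemma eigenvector_cases:
  assumes S: "vec.subspace S" "S \<noteq> {0}"
  obtains x where "isotropic_eigenvector S x"
  | x where "x \<in> S" "a x x \<noteq> 0" "\<And>s. s \<in> S \<Longrightarrow> b s x = 0"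
proof -
  obtain x \<alpha> \<beta> where x: "x \<in> S" "x \<noteq> 0" and nz: "\<alpha> \<noteq> 0 \<or> \<beta> \<noteq> 0"
    and eq: "\<forall>s\<in>S. \<alpha> * a s x + \<beta> * b s x = 0"
    using kernel_of_form_pencil[OF functional_a functional_a' functional_b functional_b' S] by metis
  show ?thesis
  proof (cases "a x x = 0")
    case True
    then show ?thesis using x nz eq that(1)[of x] unfolding isotropic_eigenvector_def by blast
  next
    case False
    have "\<alpha> * a x x = 0" using eq x(1) b_diag[of x] by force
    then have "\<alpha> = 0" using False by simp
    then have "b s x = 0" if "s \<in> S" for s using nz eq that by auto
    then show ?thesis using that(2)[of x] x(1) False by blast
  qed
qed

text \<open>Suppose the eigenvector \<open>x\<close> found first is anisotropic and in the kernel of \<open>b\<close>. Then \<open>S\<close> is the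
  direct sum of the line of \<open>x\<close> and its \<open>a\<close>-complement \<open>W\<close>, and this sum is orthogonal for both forms.
  So every eigenvector in \<open>W\<close> is one in \<open>S\<close>, and if it is again anisotropic then a suitable
  combination with \<open>x\<close> is isotropic.\<close>

lemma ex_isotropic_eigenvector:
  assumes S: "vec.subspace S" and dim: "2 \<le> vec.dim S"
  shows "\<exists>x. isotropic_eigenvector S x"
proof -
  have "S \<noteq> {0}" using dim by auto
  from S this show ?thesis
  proof (cases rule: eigenvector_cases)
    case (1 x)
    then show ?thesis by blast
  next
    case (2 x)
    define W where "W = {w \<in> S. a x w = 0}"
    have W: "vec.subspace W"
      unfolding W_def by (rule subspace_kernel_section[OF functional_a S])
    have "vec.dim S = vec.dim W + 1"
      unfolding W_def by (rule dim_hyperplane_section[OF functional_a S 2(1,2)])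
    then have "W \<noteq> {0}" using dim by auto
    have split: "s - (a x s / a x x) *s x \<in> W" if "s \<in> S" for s
      using that 2(1,2) S by (simp add: W_def vec.subspace_diff vec.subspace_scale form_simps)
    have bx: "b x s = 0" if "s \<in> S" for s using 2(3)[OF that] skew[of x s] by simp
    have lift: "c * a s w + d * b s w = 0"
      if w: "w \<in> W" and eq: "\<forall>t\<in>W. c * a t w + d * b t w = 0" and s: "s \<in> S" for c d w s
    proof -
      have "a x w = 0" "b x w = 0" using w bx by (auto simp: W_def)
      then show ?thesis using eq[rule_format, OF split[OF s]] by (simp add: form_simps)
    qed
    from W \<open>W \<noteq> {0}\<close> show ?thesis
    proof (cases rule: eigenvector_cases)
      case w: (1 w)
      then have "isotropic_eigenvector S w"
        unfolding isotropic_eigenvector_def using lift W_def by blast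
      then show ?thesis ..
    next
      case w: (2 w)
      have bw: "b s w = 0" if "s \<in> S" for s
        using lift[of w 0 1 s] w that by simp
      define t where "t = csqrt (- a x x / a w w)"
      have t2: "t * t = - a x x / a w w" unfolding t_def by (metis power2_csqrt power2_eq_square)
      define y where "y = x + t *s w"
      have xw: "w \<in> S" "a x w = 0" "a w x = 0" using w(1) sym[of w x] by (auto simp: W_def)
      have "a y y = a x x + (t * t) * a w w"
        unfolding y_def using xw by (simp add: form_simps)
      then have "a y y = 0" using w(2) by (simp add: t2)
      moreover have "a x y = a x x" unfolding y_def using xw by (simp add: form_simps)
      then have "y \<noteq> 0" using 2(2) form_simps by auto
      moreover have "y \<in> S" unfolding y_def using S 2(1) xw by (simp add: vec.subspace_add vec.subspace_scale)
      moreover have "\<forall>s\<in>S. 0 * a s y + 1 * b s y = 0"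
        unfolding y_def using 2(3) bw by (simp add: form_simps)
      ultimately have "isotropic_eigenvector S y"
        unfolding isotropic_eigenvector_def by (metis zero_neq_one)
      then show ?thesis ..
    qed
  qed
qed

section \<open>Radicals and reduction of the rank\<close>

definition rad :: "complex \<Rightarrow> (complex^'n) set \<Rightarrow> (complex^'n) set" where
  "rad z S = {y \<in> S. \<forall>s\<in>S. a s y + z * b s y = 0}"

lemma subspace_rad: "vec.subspace S \<Longrightarrow> vec.subspace (rad z S)"
  by (auto simp: rad_def vec.subspace_def form_simps algebra_simps)
    (metis distrib_left mult.left_commute mult_zero_right)

text \<open>The rank of a form on \<open>S\<close> is the codimension of its radical. Finitely many parameters are exempt
  because a reduction step controls the radical only where the scalar in front of the common
  functional does not vanish.\<close>

definition rank_le_on :: "(complex^'n) set \<Rightarrow> nat \<Rightarrow> bool" where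
  "rank_le_on S r \<longleftrightarrow> (\<exists>F. finite F \<and> (\<forall>z. z \<notin> F \<longrightarrow> vec.dim S \<le> vec.dim (rad z S) + r))"

text \<open>This is the claimed decomposition restricted to \<open>S\<close>, with constant factors \<open>v\<^sub>j\<close> and
  \<open>w\<^sub>j(\<lambda>) = p\<^sub>j + \<lambda> q\<^sub>j\<close>. The reflection \<open>\<lambda> \<mapsto> -\<lambda>\<close> becomes the minus sign in the formula
  for \<open>b\<close>.\<close>

definition short_decomposition :: "(complex^'n) set \<Rightarrow> nat \<Rightarrow> bool" where
  "short_decomposition S r \<longleftrightarrow> (\<exists>u v p q. functional u \<and>
     (\<forall>j. functional (v j) \<and> functional (p j) \<and> functional (q j)) \<and>
     (\<forall>x\<in>S. \<forall>y\<in>S.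
       a x y = (if even r then 0 else u x * u y) + (\<Sum>j=1..r div 2. v j x * p j y + p j x * v j y) \<and>
       b x y = (\<Sum>j=1..r div 2. v j x * q j y - q j x * v j y)))"

lemma short_decomposition_pullback:
  assumes \<pi>: "Vector_Spaces.linear (*s) (*s) \<pi>" and im: "\<And>x. x \<in> U \<Longrightarrow> \<pi> x \<in> S"
    and inv: "\<And>x y. x \<in> U \<Longrightarrow> y \<in> U \<Longrightarrow> a (\<pi> x) (\<pi> y) = a x y \<and> b (\<pi> x) (\<pi> y) = b x y"
    and S: "short_decomposition S r"
  shows "short_decomposition U r"
proof -
  obtain u v p q where lin: "functional u" "\<And>j. functional (v j)" "\<And>j. functional (p j)" "\<And>j. functional (q j)"
    and eq: "\<And>x y. x \<in> S \<Longrightarrow> y \<in> S \<Longrightarrow>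
       a x y = (if even r then 0 else u x * u y) + (\<Sum>j=1..r div 2. v j x * p j y + p j x * v j y) \<and>
       b x y = (\<Sum>j=1..r div 2. v j x * q j y - q j x * v j y)"
    using S unfolding short_decomposition_def by blast
  show ?thesis unfolding short_decomposition_def
  proof (rule exI[of _ "u \<circ> \<pi>"], rule exI[of _ "\<lambda>j. v j \<circ> \<pi>"], rule exI[of _ "\<lambda>j. p j \<circ> \<pi>"],
      rule exI[of _ "\<lambda>j. q j \<circ> \<pi>"], intro conjI allI ballI)
    fix x y assume xy: "x \<in> U" "y \<in> U"
    note eq' = eq[OF im im, OF xy]
    show "a x y = (if even r then 0 else (u \<circ> \<pi>) x * (u \<circ> \<pi>) y) +
        (\<Sum>j=1..r div 2. (v j \<circ> \<pi>) x * (p j \<circ> \<pi>) y + (p j \<circ> \<pi>) x * (v j \<circ> \<pi>) y)"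
      using eq' inv[OF xy] by (simp cong: if_cong)
    show "b x y = (\<Sum>j=1..r div 2. (v j \<circ> \<pi>) x * (q j \<circ> \<pi>) y - (q j \<circ> \<pi>) x * (v j \<circ> \<pi>) y)"
      using eq' inv[OF xy] by simp
  qed (rule Vector_Spaces.linear_compose[OF \<pi>] lin)+
qed

lemma linear_projection_along:
  assumes "functional f"
  shows "Vector_Spaces.linear (*s) (*s) (\<lambda>y. y - f y *s c)"
  unfolding Vector_Spaces.linear_iff using assms
  by (auto simp: functional_simps vec.scale_left_distrib vec.scale_right_diff_distrib
      vec.vector_space_axioms algebra_simps)

text \<open>Let \<open>f c = 1\<close> and let \<open>\<pi> y = y - f(y) c\<close> be the projection onto \<open>ker f\<close>. Expanding \<open>a(x,y)\<close>
  leaves, besides \<open>a(\<pi> x, \<pi> y)\<close>, the terms \<open>f(x) a(c,y) + a(x,c) f(y) - f(x) f(y) a(c,c)\<close>, and sharing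
  the last one evenly between the first two puts them into the form of a single pair. For \<open>b\<close> the last
  term vanishes.\<close>

lemma short_decomposition_hyperplane:
  assumes f: "functional f" and S: "vec.subspace S"
    and nz: "\<exists>c\<in>S. f c \<noteq> 0" and U: "short_decomposition {s \<in> S. f s = 0} r"
  shows "short_decomposition S (r + 2)"
proof -
  obtain c0 where c0: "c0 \<in> S" "f c0 \<noteq> 0" using nz by blast
  define c where "c = inverse (f c0) *s c0"
  have c: "c \<in> S" "f c = 1" using c0 S f by (simp_all add: c_def vec.subspace_scale functional_simps)
  let ?U = "{s \<in> S. f s = 0}"
  define \<pi> where "\<pi> y = y - f y *s c" for y
  have \<pi>: "Vector_Spaces.linear (*s) (*s) \<pi>"
    unfolding \<pi>_def using f by (rule linear_projection_along)
  have \<pi>U: "\<pi> y \<in> ?U" if "y \<in> S" for y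
    unfolding \<pi>_def using that c S f by (simp add: vec.subspace_diff vec.subspace_scale functional_simps)
  obtain u v p q where lin: "functional u" "\<And>j. functional (v j)" "\<And>j. functional (p j)" "\<And>j. functional (q j)"
    and eq: "\<And>x y. x \<in> ?U \<Longrightarrow> y \<in> ?U \<Longrightarrow>
       a x y = (if even r then 0 else u x * u y) + (\<Sum>j=1..r div 2. v j x * p j y + p j x * v j y) \<and>
       b x y = (\<Sum>j=1..r div 2. v j x * q j y - q j x * v j y)"
    using U unfolding short_decomposition_def by blast
  have lin\<pi>: "functional (g \<circ> \<pi>)" if "functional g" for g
    using \<pi> that by (rule Vector_Spaces.linear_compose)
  define m where "m = Suc (r div 2)"
  define v' where "v' j = (if j = m then f else v j \<circ> \<pi>)" for j
  define p' where "p' j = (if j = m then (\<lambda>y. a c y - a c c / 2 * f y) else p j \<circ> \<pi>)" for j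
  define q' where "q' j = (if j = m then b c else q j \<circ> \<pi>)" for j
  have dm: "(r + 2) div 2 = m" by (simp add: m_def)
  have split: "(\<Sum>j=1..m. h j) = (\<Sum>j=1..r div 2. h j) + h m" for h :: "nat \<Rightarrow> complex"
    by (simp add: m_def)
  have old: "v' j = v j \<circ> \<pi>" "p' j = p j \<circ> \<pi>" "q' j = q j \<circ> \<pi>" if "j \<in> {1..r div 2}" for j
    using that by (auto simp: v'_def p'_def q'_def m_def)
  show ?thesis unfolding short_decomposition_def dm
  proof (rule exI[of _ "u \<circ> \<pi>"], rule exI[of _ v'], rule exI[of _ p'], rule exI[of _ q'],
      intro conjI allI ballI)
    show "functional (u \<circ> \<pi>)" by (intro lin\<pi> lin)
    show "functional (v' j)" for j using f lin(2) lin\<pi> by (simp add: v'_def)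
    show "functional (q' j)" for j using functional_b lin(4) lin\<pi> by (simp add: q'_def)
    have "functional (\<lambda>y. a c y - a c c / 2 * f y)"
      by (rule functionalI) (simp_all add: form_simps functional_simps[OF f] algebra_simps)
    then show "functional (p' j)" for j using lin(3) lin\<pi> by (simp add: p'_def)
  next
    fix x y assume xy: "x \<in> S" "y \<in> S"
    note eq' = eq[OF \<pi>U \<pi>U, OF xy]
    have "a x y = a (\<pi> x) (\<pi> y) + (f x * p' m y + p' m x * f y)"
      by (simp add: \<pi>_def p'_def form_simps sym[of x c] field_simps)
    then show "a x y = (if even (r + 2) then 0 else (u \<circ> \<pi>) x * (u \<circ> \<pi>) y) +
        (\<Sum>j=1..m. v' j x * p' j y + p' j x * v' j y)"
      unfolding split using eq' by (simp add: old v'_def[of m] cong: if_cong)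
    have "b x y = b (\<pi> x) (\<pi> y) + (f x * q' m y - q' m x * f y)"
      by (simp add: \<pi>_def q'_def form_simps skew[of x c] b_diag algebra_simps)
    then show "b x y = (\<Sum>j=1..m. v' j x * q' j y - q' j x * v' j y)"
      unfolding split using eq' by (simp add: old v'_def[of m])
  qed
qed

text \<open>The quotient of \<open>U\<close> by a common radical vector \<open>x\<close> is realised as the section of \<open>U\<close> by a
  coordinate hyperplane that misses \<open>x\<close>; the projection along \<open>x\<close> preserves both forms.\<close>

lemma drop_radical_vector:
  assumes U: "vec.subspace U" and x: "x \<in> U" "x $ i \<noteq> 0"
    and orth: "\<And>s. s \<in> U \<Longrightarrow> a s x = 0 \<and> b s x = 0"
  defines "S \<equiv> {s \<in> U. s $ i = 0}"
  shows "vec.subspace S" "vec.dim U = vec.dim S + 1"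
    "vec.dim (rad z U) \<le> vec.dim (rad z S) + 1"
    "short_decomposition S r \<Longrightarrow> short_decomposition U r"
proof -
  show "vec.subspace S" unfolding S_def using functional_coordinate U by (rule subspace_kernel_section)
  show "vec.dim U = vec.dim S + 1"
    unfolding S_def using functional_coordinate U x by (rule dim_hyperplane_section)
  have "vec.dim (rad z U) \<le> vec.dim {y \<in> rad z U. y $ i = 0} + 1"
    using functional_coordinate subspace_rad[OF U] by (rule dim_hyperplane_section_le)
  moreover have "{y \<in> rad z U. y $ i = 0} \<subseteq> rad z S" by (auto simp: rad_def S_def)
  ultimately show "vec.dim (rad z U) \<le> vec.dim (rad z S) + 1"
    using vec.dim_subset by (meson add_le_cancel_right order_trans)
  have orth': "a x s = 0 \<and> b x s = 0" if "s \<in> U" for s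
    using orth[OF that] sym[of x s] skew[of x s] by simp
  have f: "functional (\<lambda>y. y $ i / x $ i)"
    by (rule functionalI) (simp_all add: add_divide_distrib)
  assume dec: "short_decomposition S r"
  show "short_decomposition U r"
  proof (rule short_decomposition_pullback[OF linear_projection_along[OF f, of x] _ _ dec])
    fix y assume y: "y \<in> U"
    then show "y - (y $ i / x $ i) *s x \<in> S"
      using x U by (simp add: S_def vec.subspace_diff vec.subspace_scale)
  next
    fix y y' assume "y \<in> U" "y' \<in> U"
    then show "a (y - (y $ i / x $ i) *s x)
        (y' - (y' $ i / x $ i) *s x) = a y y' \<and>
      b (y - (y $ i / x $ i) *s x)
        (y' - (y' $ i / x $ i) *s x) = b y y'"
      using orth orth' x(1) by (simp add: form_simps)
  qed
qed

lemma short_decomposition_trivial: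
  "short_decomposition {0} r"
proof -
  have z: "functional (\<lambda>x :: complex^'n. 0)" by (rule functionalI) simp_all
  show ?thesis unfolding short_decomposition_def
    by (intro exI[of _ "\<lambda>x :: complex^'n. 0"] exI[of _ "\<lambda>(j::nat) (x :: complex^'n). 0"])
      (simp add: z form_simps)
qed

text \<open>Dependence of \<open>a(\<cdot>,x)\<close> and \<open>b(\<cdot>,x)\<close> makes both multiples of one functional, taken to be
  whichever of the two is certain to be nonzero.\<close>

lemma common_functional:
  assumes x: "isotropic_eigenvector S x" and nz: "\<exists>s\<in>S. a s x \<noteq> 0 \<or> b s x \<noteq> 0"
  obtains f \<mu> \<nu> where "functional f" "\<mu> \<noteq> 0 \<or> \<nu> \<noteq> 0" "\<exists>s\<in>S. f s \<noteq> 0"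
    "\<forall>s\<in>S. a s x = \<mu> * f s" "\<forall>s\<in>S. b s x = \<nu> * f s"
proof -
  obtain \<alpha> \<beta> where ab: "\<alpha> \<noteq> 0 \<or> \<beta> \<noteq> 0" "\<And>s. s \<in> S \<Longrightarrow> \<alpha> * a s x + \<beta> * b s x = 0"
    using x unfolding isotropic_eigenvector_def by blast
  show ?thesis
  proof (cases "\<alpha> = 0")
    case True
    then have "b s x = 0" if "s \<in> S" for s using ab that by auto
    then show ?thesis
      using nz by (intro that[of "\<lambda>s. a s x" 1 0]) (auto intro: functional_a')
  next
    case False
    then have a_eq: "a s x = (- \<beta> / \<alpha>) * b s x" if "s \<in> S" for s
      using ab(2)[OF that] by (simp add: field_simps eq_neg_iff_add_eq_0)
    then have "\<exists>s\<in>S. b s x \<noteq> 0" using nz by force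
    with a_eq show ?thesis
      by (intro that[of "\<lambda>s. b s x" "- \<beta> / \<alpha>" 1]) (auto intro: functional_b')
  qed
qed

text \<open>By symmetry of \<open>a\<close> and skewness of \<open>b\<close>, the form \<open>a + zb\<close> pairs \<open>x\<close> with \<open>s\<close> to
  \<open>(\<mu> + z\<nu>) f(s)\<close> on one side and to \<open>(\<mu> - z\<nu>) f(s)\<close> on the other. Where both factors are nonzero,
  the radical on \<open>S\<close> lies in \<open>ker f\<close> and does not contain \<open>x\<close>, whereas the radical on \<open>ker f\<close> does.
  Hence the radical on \<open>T\<close>, which is \<open>ker f\<close> modulo \<open>x\<close>, is at least as large as that on \<open>S\<close>,
  although \<open>T\<close> has two dimensions fewer.\<close>

lemma rank_drop:
  assumes S: "vec.subspace S" and r: "rank_le_on S r"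
    and f: "functional f" "\<exists>s\<in>S. f s \<noteq> 0"
    and x: "x \<in> S" "f x = 0" "x $ i \<noteq> 0" and \<mu>\<nu>: "\<mu> \<noteq> 0 \<or> \<nu> \<noteq> 0"
    and ax: "\<And>s. s \<in> S \<Longrightarrow> a s x = \<mu> * f s" and bx: "\<And>s. s \<in> S \<Longrightarrow> b s x = \<nu> * f s"
  defines "T \<equiv> {s \<in> {s \<in> S. f s = 0}. s $ i = 0}"
  shows "2 \<le> r" "rank_le_on T (r - 2)"
proof -
  define U where "U = {s \<in> S. f s = 0}"
  have U: "vec.subspace U" unfolding U_def using f(1) S by (rule subspace_kernel_section)
  have xU: "x \<in> U" using x by (simp add: U_def)
  have orth: "a s x = 0 \<and> b s x = 0" if "s \<in> U" for s
    using that ax bx by (simp add: U_def)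
  have T: "T = {s \<in> U. s $ i = 0}" by (simp add: T_def U_def)
  note drop = drop_radical_vector[OF U xU x(3) orth, folded T]
  obtain c where c: "c \<in> S" "f c \<noteq> 0" using f(2) by blast
  have dimS: "vec.dim S = vec.dim U + 1"
    unfolding U_def using f(1) S c by (rule dim_hyperplane_section)
  obtain F where F: "finite F" "\<And>z. z \<notin> F \<Longrightarrow> vec.dim S \<le> vec.dim (rad z S) + r"
    using r unfolding rank_le_on_def by blast
  \<comment> \<open>the parameters at which one of the factors \<open>\<mu> + z\<nu>\<close> and \<open>\<mu> - z\<nu>\<close> vanishes are exempted\<close>
  define G where "G = F \<union> {- \<mu> / \<nu>, \<mu> / \<nu>}"
  have key: "vec.dim T + 2 \<le> vec.dim (rad z T) + r" if "z \<notin> G" for z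
  proof -
    have nz: "\<mu> + z * \<nu> \<noteq> 0" "\<mu> - z * \<nu> \<noteq> 0"
      using that \<mu>\<nu> by (cases "\<nu> = 0"; auto simp: G_def field_simps eq_neg_iff_add_eq_0)+
    have sub: "rad z S \<subseteq> U"
    proof
      fix y assume y: "y \<in> rad z S"
      then have "a x y + z * b x y = 0" "y \<in> S" using x(1) by (auto simp: rad_def)
      then have "(\<mu> - z * \<nu>) * f y = 0"
        using ax[of y] bx[of y] sym[of x y] skew[of x y] by (simp add: algebra_simps)
      then show "y \<in> U" using nz \<open>y \<in> S\<close> by (simp add: U_def)
    qed
    have "x \<notin> rad z S"
    proof
      assume "x \<in> rad z S"
      then have "a c x + z * b c x = 0" using c by (auto simp: rad_def)
      then have "(\<mu> + z * \<nu>) * f c = 0" using ax[OF c(1)] bx[OF c(1)] by (simp add: algebra_simps)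
      then show False using nz c by simp
    qed
    then have "vec.dim (insert x (rad z S)) = vec.dim (rad z S) + 1"
      by (simp add: vec.dim_insert vec.span_eq_iff[THEN iffD2, OF subspace_rad[OF S]])
    moreover have "insert x (rad z S) \<subseteq> rad z U"
      using sub xU orth by (auto simp: rad_def U_def)
    then have "vec.dim (insert x (rad z S)) \<le> vec.dim (rad z U)" by (rule vec.dim_subset)
    ultimately have "vec.dim (rad z S) \<le> vec.dim (rad z T)" using drop(3)[of z] by simp
    moreover have "z \<notin> F" using that by (simp add: G_def)
    ultimately show ?thesis using F(2)[of z] dimS drop(2) by simp
  qed
  have G: "finite G" using F(1) by (simp add: G_def)
  then obtain z where z: "z \<notin> G"
    using ex_new_if_finite[of G] infinite_UNIV_char_0 by metis
  have "vec.dim (rad z T) \<le> vec.dim T" by (rule vec.dim_subset) (auto simp: rad_def)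
  then show "2 \<le> r" using key[OF z] by simp
  then have "vec.dim T \<le> vec.dim (rad z T) + (r - 2)" if "z \<notin> G" for z
    using key[OF that] by simp
  then show "rank_le_on T (r - 2)" unfolding rank_le_on_def using G by blast
qed

text \<open>For odd \<open>r\<close> the form \<open>a\<close> is a square on the line. For even \<open>r\<close>, anisotropy forces \<open>r \<ge> 2\<close>, and
  one pair of outer products suffices because the hyperplane section of the line is zero.\<close>

lemma short_decomposition_line:
  assumes S: "vec.subspace S" and dim: "vec.dim S = 1" and x: "x \<in> S" "x $ i \<noteq> 0" "a x x \<noteq> 0"
    and r: "rank_le_on S r"
  shows "short_decomposition S r"
proof -
  have dim0: "vec.dim {s \<in> S. s $ i = 0} = 0"
    using dim_hyperplane_section[OF functional_coordinate S x(1,2)] dim by simp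
  then have zero: "s = 0" if "s \<in> S" "s $ i = 0" for s using that by auto
  have sx: "s = (s $ i / x $ i) *s x" if "s \<in> S" for s
  proof -
    have "s - (s $ i / x $ i) *s x = 0"
      using that x S by (intro zero) (simp_all add: vec.subspace_diff vec.subspace_scale)
    then show ?thesis by simp
  qed
  show ?thesis
  proof (cases "even r")
    case False
    define u where "u y = csqrt (a x x) / x $ i * y $ i" for y :: "complex^'n"
    have u: "functional u" unfolding u_def by (rule functionalI) (simp_all add: algebra_simps add_divide_distrib)
    have z: "functional (\<lambda>x :: complex^'n. 0)" by (rule functionalI) simp_all
    have ux: "u x * u x = a x x"
      using x(2) by (simp add: u_def power2_eq_square[symmetric])
    have auy: "a s t = u s * u t" "b s t = 0" if st: "s \<in> S" "t \<in> S" for s t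
    proof -
      obtain c d where cd: "s = c *s x" "t = d *s x" using sx[OF st(1)] sx[OF st(2)] by blast
      show "a s t = u s * u t" unfolding cd using ux
        by (simp add: form_simps functional_simps[OF u])
      show "b s t = 0" unfolding cd by (simp add: form_simps b_diag)
    qed
    show ?thesis unfolding short_decomposition_def
      by (intro exI[of _ u] exI[of _ "\<lambda>(j::nat) (x :: complex^'n). 0"])
        (use False in \<open>simp add: z u auy\<close>)
  next
    case True
    obtain F where F: "finite F" "\<And>z. z \<notin> F \<Longrightarrow> vec.dim S \<le> vec.dim (rad z S) + r"
      using r unfolding rank_le_on_def by blast
    obtain z where z: "z \<notin> F"
      using F(1) ex_new_if_finite[of F] infinite_UNIV_char_0 by metis
    have "r \<noteq> 0"
    proof
      assume "r = 0"
      then have "vec.dim S \<le> vec.dim (rad z S)" using F(2)[OF z] by simp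
      moreover have "rad z S \<subseteq> S" by (auto simp: rad_def)
      ultimately have "rad z S = S"
        using S subspace_rad[OF S] by (intro vec.subspace_dim_equal)
      then have "a x x + z * b x x = 0" using x(1) unfolding rad_def by blast
      then show False using x(3) by (simp add: b_diag)
    qed
    then have "r = (r - 2) + 2" using True by (cases r) (auto elim: evenE)
    moreover have "{s \<in> S. s $ i = 0} = {0}" using zero S by (auto simp: vec.subspace_0)
    then have "short_decomposition S ((r - 2) + 2)"
      using x by (intro short_decomposition_hyperplane[OF functional_coordinate S, of i])
        (auto simp: short_decomposition_trivial)
    ultimately show ?thesis by simp
  qed
qed

text \<open>Without an isotropic eigenvector \<open>S\<close> is at most a line; with one, the reduction depends on whether
  it is in the radical of both forms.\<close>

lemma short_decomposition_of_rank:
  assumes "vec.subspace S" "rank_le_on S r"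
  shows "short_decomposition S r"
  using assms
proof (induction "vec.dim S" arbitrary: S r rule: less_induct)
  case (less S r)
  note S = less.prems(1)
  show ?case
  proof (cases "S = {0}")
    case True
    then show ?thesis by (simp add: short_decomposition_trivial)
  next
    case nontriv: False
    show ?thesis
    proof (cases "\<exists>x. isotropic_eigenvector S x")
      case False
      then have "vec.dim S < 2" using ex_isotropic_eigenvector[OF S] by fastforce
      moreover have "vec.dim S \<noteq> 0" using nontriv S vec.subspace_0 by auto
      ultimately have dim: "vec.dim S = 1" by linarith
      obtain x where x: "x \<in> S" "a x x \<noteq> 0" using eigenvector_cases[OF S nontriv] False by metis
      then have "x \<noteq> 0" using form_simps by auto
      then obtain i where "x $ i \<noteq> 0" by (auto simp: vec_eq_iff)
      then show ?thesis using short_decomposition_line[OF S dim] x less.prems(2) by blast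
    next
      case True
      then obtain x where x: "isotropic_eigenvector S x" ..
      then have xS: "x \<in> S" "a x x = 0" and "x \<noteq> 0" by (auto simp: isotropic_eigenvector_def)
      then obtain i where xi: "x $ i \<noteq> 0" by (auto simp: vec_eq_iff)
      show ?thesis
      proof (cases "\<exists>s\<in>S. a s x \<noteq> 0 \<or> b s x \<noteq> 0")
        case False
        then have orth: "a s x = 0 \<and> b s x = 0" if "s \<in> S" for s using that by blast
        note drop = drop_radical_vector[OF S xS(1) xi orth]
        let ?T = "{s \<in> S. s $ i = 0}"
        obtain F where F: "finite F" "\<And>z. z \<notin> F \<Longrightarrow> vec.dim S \<le> vec.dim (rad z S) + r"
          using less.prems(2) unfolding rank_le_on_def by blast
        have "vec.dim ?T \<le> vec.dim (rad z ?T) + r" if "z \<notin> F" for z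
          using F(2)[OF that] drop(2) drop(3)[of z] by simp
        then have "rank_le_on ?T r" unfolding rank_le_on_def using F(1) by blast
        moreover have "vec.dim ?T < vec.dim S" using drop(2) by simp
        ultimately show ?thesis using less.hyps drop(1,4) by blast
      next
        case True
        obtain f \<mu> \<nu> where f: "functional f" "\<mu> \<noteq> 0 \<or> \<nu> \<noteq> 0" "\<exists>s\<in>S. f s \<noteq> 0"
          and "\<forall>s\<in>S. a s x = \<mu> * f s" and "\<forall>s\<in>S. b s x = \<nu> * f s"
          by (rule common_functional[OF x True])
        then have ax: "\<And>s. s \<in> S \<Longrightarrow> a s x = \<mu> * f s" and bx: "\<And>s. s \<in> S \<Longrightarrow> b s x = \<nu> * f s"
          by blast+
        have fx: "f x = 0" using ax[OF xS(1)] bx[OF xS(1)] xS(2) f(2) b_diag[of x] by auto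
        let ?U = "{s \<in> S. f s = 0}"
        let ?T = "{s \<in> ?U. s $ i = 0}"
        have U: "vec.subspace ?U" using f(1) S by (rule subspace_kernel_section)
        have orth: "a s x = 0 \<and> b s x = 0" if "s \<in> ?U" for s using that ax bx by simp
        have "x \<in> ?U" using xS fx by simp
        note drop = drop_radical_vector[OF U this xi orth]
        note rank = rank_drop[OF S less.prems(2) f(1,3) xS(1) fx xi f(2) ax bx]
        have "vec.dim ?U \<le> vec.dim S" by (rule vec.dim_subset) auto
        then have "vec.dim ?T < vec.dim S" using drop(2) by simp
        then have "short_decomposition ?T (r - 2)" using less.hyps drop(1) rank(2) by blast
        then have "short_decomposition ?U (r - 2)" using drop(4) by simp
        then have "short_decomposition S (r - 2 + 2)"
          by (rule short_decomposition_hyperplane[OF f(1) S f(3)])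
        moreover have "r - 2 + 2 = r" using rank(1) by simp
        ultimately show ?thesis by metis
      qed
    qed
  qed
qed

end

section \<open>T-even pencils\<close>

theorem theorem6:
  fixes E :: "complex poly^'n^'n" and r s :: nat
  assumes "T_even_pencil E"
    and "normal_rank E = r"
    and "r \<le> CARD('n)"
    and "s = r div 2"
  shows "\<exists>(u :: complex poly^'n) (v :: nat \<Rightarrow> complex poly^'n) (w :: nat \<Rightarrow> complex poly^'n).
    vec_degree u = 0 \<and>
    (\<forall>j\<in>{1..s}. vec_degree (v j) = 0 \<and> vec_degree (w j) \<le> 1) \<and>
    E = (if even r
         then (\<Sum>j=1..s. outer (v j) (w j)) + (\<Sum>j=1..s. outer (reflect_vec (w j)) (v j))
         else outer u u + (\<Sum>j=1..s. outer (v j) (w j)) + (\<Sum>j=1..s. outer (reflect_vec (w j)) (v j)))"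
proof -
  obtain A B where E: "E = pencil A B" and A: "transpose A = A" and B: "transpose B = - B"
    using assms(1) unfolding T_even_pencil_def by blast
  have A': "A $ i $ j = A $ j $ i" and B': "B $ i $ j = - B $ j $ i" for i j
    using arg_cong[OF A, of "\<lambda>M. M $ j $ i"] arg_cong[OF B, of "\<lambda>M. M $ j $ i"]
    by (simp_all add: transpose_def)
  define form where "form M x y = (\<Sum>i\<in>UNIV. x $ i * (M *v y) $ i)" for M :: "complex^'n^'n" and x y
  have form2: "form M x y = (\<Sum>i\<in>UNIV. \<Sum>j\<in>UNIV. x $ i * M $ i $ j * y $ j)" for M x y
    by (simp add: form_def matrix_vector_mult_def sum_distrib_left mult.assoc)
  have form_axis: "form M (axis i 1) (axis j 1) = M $ i $ j" for M i j
    by (simp add: form_def axis_def matrix_vector_mult_def if_distrib if_distribR cong: if_cong)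
  interpret even_form_pair "form A" "form B"
  proof (rule even_form_pair.intro)
    fix x y
    have lin: "functional (form M x)" for M x
      by (rule functionalI) (simp_all add: form2 sum.distrib sum_distrib_left algebra_simps)
    show "functional (form A x)" "functional (form B x)" by (rule lin)+
    show "form A x y = form A y x"
      unfolding form2 by (subst sum.swap) (intro sum.cong refl, subst A', simp)
    show "form B x y = - form B y x"
      unfolding form2 sum_negf[symmetric] by (subst sum.swap) (intro sum.cong refl, subst B', simp)
  qed
  have "CARD('n) \<le> vec.dim (rad z UNIV) + r" for z
  proof -
    have ev: "eval_pmat E z *v y = (\<chi> i. (A *v y) $ i + z * (B *v y) $ i)" for y
      by (simp add: E eval_pmat_pencil matrix_vector_mult_def vec_eq_iff sum.distrib
          sum_distrib_left algebra_simps)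
    have "{y. eval_pmat E z *v y = 0} \<subseteq> rad z UNIV"
    proof
      fix y assume "y \<in> {y. eval_pmat E z *v y = 0}"
      then have "(A *v y) $ i + z * (B *v y) $ i = 0" for i by (simp add: ev vec_eq_iff)
      then have "x $ i * (A *v y) $ i + z * (x $ i * (B *v y) $ i) = 0" for x :: "complex^'n" and i
        by (metis distrib_left mult.left_commute mult_zero_right)
      then show "y \<in> rad z UNIV"
        by (simp add: rad_def form_def sum_distrib_left sum.distrib[symmetric])
    qed
    then have "vec.dim {y. eval_pmat E z *v y = 0} \<le> vec.dim (rad z UNIV)" by (rule vec.dim_subset)
    moreover have "rank (eval_pmat E z) \<le> r"
      using assms(2) finite_range_rank_eval[of E] unfolding normal_rank_def by (metis Max_ge rangeI)
    ultimately show ?thesis using dim_matrix_kernel[of "eval_pmat E z"] by simp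
  qed
  then have "rank_le_on UNIV r"
    unfolding rank_le_on_def vec_dim_card by (intro exI[of _ "{}"]) simp
  then have "short_decomposition UNIV r"
    using vec.subspace_UNIV by (intro short_decomposition_of_rank)
  then obtain u v p q where lin: "functional u" "\<And>j. functional (v j)" "\<And>j. functional (p j)" "\<And>j. functional (q j)"
    and a: "\<And>x y. form A x y = (if even r then 0 else u x * u y) + (\<Sum>j=1..s. v j x * p j y + p j x * v j y)"
    and b: "\<And>x y. form B x y = (\<Sum>j=1..s. v j x * q j y - q j x * v j y)"
    unfolding short_decomposition_def assms(4) by blast
  define U where "U = (\<chi> i. [:u (axis i 1):])"
  define V where "V j = (\<chi> i. [:v j (axis i 1):])" for j
  define W where "W j = (\<chi> i. [:p j (axis i 1), q j (axis i 1):])" for j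
  have deg: "vec_degree U = 0" "vec_degree (V j) = 0" "vec_degree (W j) \<le> 1" for j
  proof -
    show "vec_degree U = 0" "vec_degree (V j) = 0" by (auto simp: vec_degree_def U_def V_def)
    show "vec_degree (W j) \<le> 1" unfolding vec_degree_def W_def by (rule Max.boundedI) auto
  qed
  have rhs: "((\<Sum>j=1..s. outer (V j) (W j)) + (\<Sum>j=1..s. outer (reflect_vec (W j)) (V j))) $ i $ k =
      [:\<Sum>j=1..s. v j (axis i 1) * p j (axis k 1) + p j (axis i 1) * v j (axis k 1),
        \<Sum>j=1..s. v j (axis i 1) * q j (axis k 1) - q j (axis i 1) * v j (axis k 1):]" for i k
  proof -
    have "outer (V j) (W j) $ i $ k + outer (reflect_vec (W j)) (V j) $ i $ k =
      [:v j (axis i 1) * p j (axis k 1) + p j (axis i 1) * v j (axis k 1),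
        v j (axis i 1) * q j (axis k 1) - q j (axis i 1) * v j (axis k 1):]" for j
      by (simp add: outer_def reflect_vec_def V_def W_def pcompose_pCons algebra_simps)
    moreover have "(\<Sum>j=1..s. [:c j, d j:]) = [:\<Sum>j=1..s. c j, \<Sum>j=1..s. d j:]" for c d :: "nat \<Rightarrow> complex"
      by (induction s) simp_all
    ultimately show ?thesis by (simp add: sum.distrib[symmetric])
  qed
  have uu: "outer U U $ i $ k = [:u (axis i 1) * u (axis k 1):]" for i k
    by (simp add: outer_def U_def)
  have "E $ i $ k = (if even r then 0 else outer U U $ i $ k) +
      ((\<Sum>j=1..s. outer (V j) (W j)) + (\<Sum>j=1..s. outer (reflect_vec (W j)) (V j))) $ i $ k" for i k
    unfolding rhs
    using a[of "axis i 1" "axis k 1"] b[of "axis i 1" "axis k 1"]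
    by (simp add: E pencil_def form_axis uu)
  then have decomposed: "E = (if even r then 0 else outer U U) +
      ((\<Sum>j=1..s. outer (V j) (W j)) + (\<Sum>j=1..s. outer (reflect_vec (W j)) (V j)))"
    by (simp add: vec_eq_iff)
  show ?thesis
    by (rule exI[of _ U], rule exI[of _ V], rule exI[of _ W])
      (use decomposed in \<open>simp add: deg deg(3)[unfolded One_nat_def] add.assoc\<close>)
qed

end
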